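(* The sequence $(\delta_1(1,m))_{m\ge 3}$ is non-increasing in $m$ (and thus unimodular). Here $\delta_1(1,m)$ is the natural density of the set of positive integers having exactly one divisor in $\{2,3,\ldots,m-1\}$.
   Context: For integers $n\ge 1$ and $m\ge n+2$, write $(n,m)=\{n+1,n+2,\ldots,m-1\}$ for the set of integers strictly between $n$ and $m$. $\delta_1(n,m)$ denotes the natural density of the set of positive integers having exactly one divisor in $(n,m)$. This density exists, since the condition depends only on the residue of the integer modulo $\operatorname{lcm}\{n+1,\ldots,m-1\}$. A real sequence is called unimodular (i.e. unimodal) if it has at most one local maximum. A local maximum is a maximal block of consecutive indices on which the sequence is constant, such that every term adjacent to the block (the term just before it, if any, and the term just after it, if any) is strictly smaller than the common value on the block. *)

theory Defs
  imports Complex_Main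
begin

definition has_natural_density :: "nat set \<Rightarrow> real \<Rightarrow> bool" where
  "has_natural_density A d \<longleftrightarrow> (\<lambda>N. real (card (A \<inter> {1..N})) / real N) \<longlonglongrightarrow> d"

text \<open>If the limit does not exist, the value of \<open>natural_density\<close> is unspecified.
  The lemma \<open>delta1_has_density\<close> below shows that this case does not arise for \<open>delta1\<close>.\<close>

definition natural_density :: "nat set \<Rightarrow> real" where
  "natural_density A = lim (\<lambda>N. real (card (A \<inter> {1..N})) / real N)"

definition one_divisor_between :: "nat \<Rightarrow> nat \<Rightarrow> nat set" where
  "one_divisor_between n m = {k. k > 0 \<and> card {d \<in> {n<..<m}. d dvd k} = 1}"

definition delta1 :: "nat \<Rightarrow> nat \<Rightarrow> real" where
  "delta1 n m = natural_density (one_divisor_between n m)"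

text \<open>In the next four definitions \<open>I\<close> is the index set of the sequence \<open>f\<close>, a set of
  consecutive naturals. Blocks are represented as sets of indices, because in an infinite sequence
  a maximal block may be infinite.\<close>

definition constant_block :: "nat set \<Rightarrow> (nat \<Rightarrow> real) \<Rightarrow> nat set \<Rightarrow> bool" where
  "constant_block I f B \<longleftrightarrow>
     B \<noteq> {} \<and> B \<subseteq> I \<and> (\<forall>i\<in>B. \<forall>j\<in>B. {i..j} \<subseteq> B) \<and> (\<forall>i\<in>B. \<forall>j\<in>B. f i = f j)"

definition maximal_constant_block :: "nat set \<Rightarrow> (nat \<Rightarrow> real) \<Rightarrow> nat set \<Rightarrow> bool" where
  "maximal_constant_block I f B \<longleftrightarrow>
     constant_block I f B \<and> (\<forall>C. constant_block I f C \<and> B \<subseteq> C \<longrightarrow> C = B)"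

definition local_maximum :: "nat set \<Rightarrow> (nat \<Rightarrow> real) \<Rightarrow> nat set \<Rightarrow> bool" where
  "local_maximum I f B \<longleftrightarrow>
     maximal_constant_block I f B \<and>
     (\<forall>i\<in>B. \<forall>j\<in>I - B. j = Suc i \<or> i = Suc j \<longrightarrow> f j < f i)"

definition unimodal_on :: "nat set \<Rightarrow> (nat \<Rightarrow> real) \<Rightarrow> bool" where
  "unimodal_on I f \<longleftrightarrow> (\<forall>B C. local_maximum I f B \<and> local_maximum I f C \<longrightarrow> B = C)"

lemma has_natural_density_unique:
  "has_natural_density A d \<Longrightarrow> natural_density A = d"
  unfolding has_natural_density_def natural_density_def by (rule limI)

lemma periodic_has_natural_density:
  fixes A :: "nat set" and L :: nat
  assumes L: "L > 0" and per: "\<And>k. k > 0 \<Longrightarrow> k + L \<in> A \<longleftrightarrow> k \<in> A"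
  shows "has_natural_density A (real (card (A \<inter> {1..L})) / real L)"
proof -
  define c where "c N = real (card (A \<inter> {1..N}))" for N
  define g where "g N = c N - real N * (c L / real L)" for N
  have c_Suc: "c (Suc N) = c N + (if Suc N \<in> A then 1 else 0)" for N
  proof -
    have "A \<inter> {1..Suc N} = (if Suc N \<in> A then insert (Suc N) (A \<inter> {1..N}) else A \<inter> {1..N})"
      by (auto simp: le_Suc_eq)
    then show ?thesis by (simp add: c_def)
  qed
  have c_0: "c 0 = 0" by (simp add: c_def)
  have c_add: "c (N + L) = c N + c L" for N
  proof (induction N)
    case 0
    show ?case by (simp add: c_0)
  next
    case (Suc N)
    have "Suc N + L \<in> A \<longleftrightarrow> Suc N \<in> A" by (rule per) simp
    then show ?case using Suc c_Suc[of "N + L"] c_Suc[of N] by simp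
  qed
  have g_add: "g (N + L) = g N" for N
    using L unfolding g_def c_add by (simp add: field_simps)
  define K where "K = Max ((\<lambda>N. \<bar>g N\<bar>) ` {..L})"
  have g_bound: "\<bar>g N\<bar> \<le> K" for N
  proof (induction N rule: less_induct)
    case (less N)
    show ?case
    proof (cases "N \<le> L")
      case True
      then show ?thesis by (simp add: K_def)
    next
      case False
      then have "\<bar>g (N - L)\<bar> \<le> K" using L by (intro less) auto
      then show ?thesis using g_add[of "N - L"] False by simp
    qed
  qed
  have "(\<lambda>N. g N / real N) \<longlonglongrightarrow> 0"
  proof (rule tendsto_0_le)
    show "(\<lambda>N. K / real N) \<longlonglongrightarrow> 0" by (rule lim_const_over_n)
    have "\<bar>g N\<bar> / real N \<le> \<bar>K\<bar> / real N" for N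
      using g_bound[of N] by (intro divide_right_mono) auto
    then show "\<forall>\<^sub>F N in sequentially. norm (g N / real N) \<le> norm (K / real N) * 1"
      by (intro always_eventually) simp
  qed
  then have lim: "(\<lambda>N. g N / real N + c L / real L) \<longlonglongrightarrow> 0 + c L / real L"
    by (intro tendsto_intros)
  have "\<forall>\<^sub>F N in sequentially. g N / real N + c L / real L = c N / real N"
    using eventually_gt_at_top[of 0] by eventually_elim (simp add: g_def field_simps)
  then have "(\<lambda>N. c N / real N) \<longlonglongrightarrow> c L / real L"
    using lim by (simp add: tendsto_cong)
  then show ?thesis by (simp add: has_natural_density_def c_def)
qed

lemma delta1_has_density: "has_natural_density (one_divisor_between n m) (delta1 n m)"
proof -
  define L where "L = Lcm {n<..<m}"
  have "L \<noteq> 0" unfolding L_def by (subst Lcm_0_iff) auto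
  then have "L > 0" by simp
  moreover have "k + L \<in> one_divisor_between n m \<longleftrightarrow> k \<in> one_divisor_between n m" if "k > 0" for k
  proof -
    have "d dvd k + L \<longleftrightarrow> d dvd k" if "d \<in> {n<..<m}" for d
      using that dvd_Lcm[of d "{n<..<m}"] unfolding L_def by (simp add: dvd_add_left_iff)
    then have "{d \<in> {n<..<m}. d dvd k + L} = {d \<in> {n<..<m}. d dvd k}" by blast
    then show ?thesis using that by (simp add: one_divisor_between_def)
  qed
  ultimately have "has_natural_density (one_divisor_between n m)
      (real (card (one_divisor_between n m \<inter> {1..L})) / real L)"
    by (rule periodic_has_natural_density)
  then show ?thesis using has_natural_density_unique unfolding delta1_def by metis
qed

end

(* Adjoining the candidate divisor m cannot create new members of the set when m is composite,
   since m comes with a smaller divisor. When m = p is prime, write E0 and E1 for the densities of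
   the numbers with no divisor, resp. exactly one divisor, in {2..p-1}. Divisibility by p is
   independent of divisibility by smaller numbers, so the new density is E1 - E1/p + E0/p, and the
   claim is E0 <= E1. If j has no divisor in {2..p-1} and q < p is prime, then q is the only such
   divisor of q * j; for p >= 7 the primes 2, 3, 5 give E1 >= (1/2 + 1/3 + 1/5) E0 >= E0. The cases
   p = 3, 5 hold with equality and need slightly larger subsets. *)

theory Submission
  imports Defs "HOL-Computational_Algebra.Primes"
begin

section \<open>Natural density\<close>

lemma has_natural_density_mono:
  assumes "has_natural_density A a" "has_natural_density B b" "A \<subseteq> B"
  shows "a \<le> b"
proof (rule LIMSEQ_le)
  show "(\<lambda>N. real (card (A \<inter> {1..N})) / real N) \<longlonglongrightarrow> a"
    using assms(1) by (simp add: has_natural_density_def)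
  show "(\<lambda>N. real (card (B \<inter> {1..N})) / real N) \<longlonglongrightarrow> b"
    using assms(2) by (simp add: has_natural_density_def)
  have "card (A \<inter> {1..N}) \<le> card (B \<inter> {1..N})" for N
    using assms(3) by (intro card_mono) auto
  then show "\<exists>N. \<forall>n\<ge>N. real (card (A \<inter> {1..n})) / real n \<le> real (card (B \<inter> {1..n})) / real n"
    by (auto intro!: divide_right_mono)
qed

lemma has_natural_density_nonneg:
  assumes "has_natural_density A a"
  shows "0 \<le> a"
  using assms unfolding has_natural_density_def by (rule LIMSEQ_le_const) auto

lemma has_natural_density_Un:
  assumes "has_natural_density A a" "has_natural_density B b" "A \<inter> B = {}"
  shows "has_natural_density (A \<union> B) (a + b)"
proof -
  have "card ((A \<union> B) \<inter> {1..N}) = card (A \<inter> {1..N}) + card (B \<inter> {1..N})" for N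
    unfolding Int_Un_distrib2 using assms(3) by (intro card_Un_disjoint) auto
  then show ?thesis
    using tendsto_add[OF assms(1,2)[unfolded has_natural_density_def]]
    by (simp add: has_natural_density_def add_divide_distrib)
qed

lemma has_natural_density_Diff:
  assumes "has_natural_density A a" "has_natural_density B b" "B \<subseteq> A"
  shows "has_natural_density (A - B) (a - b)"
proof -
  have "real (card ((A - B) \<inter> {1..N})) = real (card (A \<inter> {1..N})) - real (card (B \<inter> {1..N}))" for N
  proof -
    have "(A - B) \<inter> {1..N} = A \<inter> {1..N} - B \<inter> {1..N}" by auto
    moreover have sub: "B \<inter> {1..N} \<subseteq> A \<inter> {1..N}" using assms(3) by auto
    ultimately show ?thesis
      by (simp add: card_Diff_subset of_nat_diff card_mono)
  qed
  then show ?thesis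
    using tendsto_diff[OF assms(1,2)[unfolded has_natural_density_def]]
    by (simp add: has_natural_density_def diff_divide_distrib)
qed

text \<open>In \<open>N = q * (N div q) + N mod q\<close> the remainder stays below
  \<open>q\<close>, so its share of \<open>N\<close> vanishes in the limit.\<close>

lemma tendsto_div_over_n:
  assumes "q > 0"
  shows "(\<lambda>N. real (N div q) / real N) \<longlonglongrightarrow> 1 / real q"
proof -
  have "(\<lambda>N. real (N mod q) / real N) \<longlonglongrightarrow> 0"
  proof (rule tendsto_0_le)
    show "(\<lambda>N. real q / real N) \<longlonglongrightarrow> 0" by (rule lim_const_over_n)
    show "\<forall>\<^sub>F N in sequentially. norm (real (N mod q) / real N) \<le> norm (real q / real N) * 1"
      using assms by (intro always_eventually) (auto intro!: divide_right_mono simp: less_imp_le)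
  qed
  then have "(\<lambda>N. (1 - real (N mod q) / real N) / real q) \<longlonglongrightarrow> (1 - 0) / real q"
    using assms by (intro tendsto_intros) auto
  moreover have "\<forall>\<^sub>F N in sequentially. (1 - real (N mod q) / real N) / real q = real (N div q) / real N"
    using eventually_gt_at_top[of 0]
  proof eventually_elim
    case (elim N)
    have "real N = real q * real (N div q) + real (N mod q)"
      by (metis mult_div_mod_eq of_nat_add of_nat_mult)
    then have "real N - real (N mod q) = real q * real (N div q)" by linarith
    moreover have "1 - real (N mod q) / real N = (real N - real (N mod q)) / real N"
      using elim by (simp add: diff_divide_distrib)
    ultimately show ?case using assms by simp
  qed
  ultimately show ?thesis by (simp add: tendsto_cong)
qed

text \<open>Multiplication by \<open>q\<close> matches the members of \<open>A\<close> up to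
  \<open>N div q\<close> with the members of the image up to \<open>N\<close>. The counting quotient
  thus factors into the quotient for \<open>A\<close> at \<open>N div q\<close> and a factor tending
  to \<open>1 / q\<close>.\<close>

lemma has_natural_density_scale:
  assumes A: "has_natural_density A a" and q: "q > 0"
  shows "has_natural_density ((*) q ` A) (a / real q)"
proof -
  define c where "c N = real (card (A \<inter> {1..N}))" for N
  have "(*) q ` A \<inter> {1..N} = (*) q ` (A \<inter> {1..N div q})" for N
    using q by (auto simp: less_eq_div_iff_mult_less_eq ac_simps Suc_le_eq)
  then have card: "real (card ((*) q ` A \<inter> {1..N})) = c (N div q)" for N
    using q by (simp add: card_image inj_on_def c_def)
  have lim: "(\<lambda>N. c (N div q) / real (N div q) * (real (N div q) / real N)) \<longlonglongrightarrow> a * (1 / real q)"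
  proof (intro tendsto_mult tendsto_div_over_n q)
    have "filterlim (\<lambda>N. N div q) at_top sequentially"
      by (rule filterlim_at_top_div_const_nat[OF q])
    then show "(\<lambda>N. c (N div q) / real (N div q)) \<longlonglongrightarrow> a"
      using A unfolding has_natural_density_def c_def by (rule filterlim_compose[rotated])
  qed
  \<comment> \<open>For \<open>N < q\<close> the left side divides by zero and takes the value 0;
    the identity survives because \<open>c 0 = 0\<close>.\<close>
  have "c (N div q) / real (N div q) * (real (N div q) / real N) = c (N div q) / real N" for N
    by (cases "N div q = 0") (auto simp: c_def)
  with lim card show ?thesis by (simp only: has_natural_density_def times_divide_eq_right mult_1_right)
qed


section \<open>Numbers without small divisors\<close>

text \<open>These are the \<open>m\<close>-rough numbers: all prime factors are at least
  \<open>m\<close>, and 1 is included. For prime \<open>m\<close>, the density is the E0 of the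
  outline.\<close>

definition no_divisor_below :: "nat \<Rightarrow> nat set" where
  "no_divisor_below m = {k. k > 0 \<and> (\<forall>d\<in>{1<..<m}. \<not> d dvd k)}"

text \<open>The gcd divides \<open>j\<close> and is at most \<open>d\<close>, hence below
  \<open>m\<close>, which leaves only the value 1.\<close>

lemma no_divisor_below_coprime:
  assumes "j \<in> no_divisor_below m" "0 < d" "d < m"
  shows "coprime d j"
proof (rule ccontr)
  assume "\<not> coprime d j"
  then have "gcd d j \<noteq> 1" by (simp add: coprime_iff_gcd_eq_1)
  moreover have "gcd d j > 0" "gcd d j \<le> d" using assms by (auto intro: gcd_le1_nat)
  ultimately have "gcd d j \<in> {1<..<m}" using assms(3) unfolding greaterThanLessThan_iff by linarith
  then show False using assms(1) by (auto simp: no_divisor_below_def)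
qed

lemma no_divisor_below_density_ex: "\<exists>e. has_natural_density (no_divisor_below m) e"
proof -
  \<comment> \<open>Every candidate divisor below \<open>m\<close> divides \<open>fact m\<close>, so
    membership has period \<open>fact m\<close>.\<close>
  have "k + fact m \<in> no_divisor_below m \<longleftrightarrow> k \<in> no_divisor_below m" if "k > 0" for k
    using that by (auto simp: no_divisor_below_def dvd_add_left_iff dvd_fact)
  then show ?thesis
    using periodic_has_natural_density[of "fact m" "no_divisor_below m"] by auto
qed

text \<open>A number strictly between 1 and the prime \<open>p\<close> is coprime to
  \<open>p\<close>. This is the form in which divisibility by \<open>p\<close> is independent of the
  smaller divisors.\<close>

lemma dvd_prime_mult_iff_of_less:
  fixes p d j :: nat
  assumes "prime p" "d \<in> {1<..<p}"
  shows "d dvd p * j \<longleftrightarrow> d dvd j"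
proof -
  have "\<not> p dvd d" using assms(2) by (intro nat_dvd_not_less) auto
  then have "coprime d p" using assms(1) by (metis prime_imp_coprime coprime_commute)
  then show ?thesis by (rule coprime_dvd_mult_right_iff)
qed

text \<open>The numbers lost on forbidding \<open>p\<close> as well are exactly the
  \<open>p * j\<close> with \<open>j\<close> in \<open>no_divisor_below p\<close>, since the factor
  \<open>p\<close> adds no divisor below \<open>p\<close>. They have density
  \<open>e / p\<close>.\<close>

lemma no_divisor_below_Suc_prime:
  assumes p: "prime p" and e: "has_natural_density (no_divisor_below p) e"
  shows "has_natural_density (no_divisor_below (Suc p)) (e - e / real p)"
proof -
  have p1: "1 < p" using p by (rule prime_gt_1_nat)
  note dvd = dvd_prime_mult_iff_of_less[OF p]
  have sub: "(*) p ` no_divisor_below p \<subseteq> no_divisor_below p"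
    using dvd p1 by (auto simp: no_divisor_below_def)
  have "no_divisor_below (Suc p) = no_divisor_below p - (*) p ` no_divisor_below p"
  proof (intro equalityI subsetI)
    fix k assume "k \<in> no_divisor_below (Suc p)"
    with p1 have "\<not> p dvd k" "k \<in> no_divisor_below p" by (auto simp: no_divisor_below_def)
    then show "k \<in> no_divisor_below p - (*) p ` no_divisor_below p" by auto
  next
    fix k assume k: "k \<in> no_divisor_below p - (*) p ` no_divisor_below p"
    have "\<not> p dvd k"
    proof
      assume "p dvd k"
      then obtain j where j: "k = p * j" by (elim dvdE)
      with k dvd have "j \<in> no_divisor_below p" by (auto simp: no_divisor_below_def)
      with j k show False by auto
    qed
    with k show "k \<in> no_divisor_below (Suc p)"
      by (auto simp: no_divisor_below_def less_Suc_eq)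
  qed
  then show ?thesis
    using has_natural_density_Diff[OF e has_natural_density_scale[OF e] sub] p1 by simp
qed


section \<open>Numbers with exactly one small divisor\<close>

text \<open>A divisor \<open>d\<close> of \<open>q * j\<close> in the range other than
  \<open>q\<close> would be coprime to \<open>j\<close>, hence would divide the prime
  \<open>q\<close>. Since \<open>q\<close> itself is exempt from the coprimality condition,
  \<open>j\<close> may be a multiple of \<open>q\<close>; the case \<open>p = 5\<close> relies on
  this freedom.\<close>

lemma one_divisor_betweenI:
  assumes "prime q" "q < m" "j > 0" "\<And>d. d \<in> {1<..<m} - {q} \<Longrightarrow> coprime d j"
  shows "q * j \<in> one_divisor_between 1 m"
proof -
  have "d = q" if "d \<in> {1<..<m}" "d dvd q * j" for d
  proof (rule ccontr)
    assume "d \<noteq> q"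
    with that assms(4) have "d dvd q" by (simp add: coprime_dvd_mult_left_iff)
    with \<open>prime q\<close> \<open>d \<noteq> q\<close> that show False by (auto simp: prime_nat_iff)
  qed
  moreover have "1 < q" using assms(1) by (rule prime_gt_1_nat)
  ultimately have "{d \<in> {1<..<m}. d dvd q * j} = {q}" using assms(2) by auto
  with assms(3) \<open>1 < q\<close> show ?thesis by (simp add: one_divisor_between_def)
qed

lemma scaled_no_divisor_below_subset:
  assumes "prime q" "q < m"
  shows "(*) q ` no_divisor_below m \<subseteq> one_divisor_between 1 m"
proof
  fix k assume "k \<in> (*) q ` no_divisor_below m"
  then obtain j where j: "k = q * j" "j \<in> no_divisor_below m" by auto
  then have "j > 0" by (simp add: no_divisor_below_def)
  then show "k \<in> one_divisor_between 1 m"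
    unfolding j(1) using assms no_divisor_below_coprime[OF j(2)]
    by (intro one_divisor_betweenI) auto
qed

lemma no_divisor_density_le_delta1:
  assumes p: "prime p" "3 \<le> p" and e: "has_natural_density (no_divisor_below p) e"
  shows "e \<le> delta1 1 p"
proof -
  have e0: "0 \<le> e" using e by (rule has_natural_density_nonneg)
  \<comment> \<open>Excluding 4 leaves 3, 5 and \<open>6 \<le> p\<close>; the last bound places 2, 3
    and 5 below \<open>p\<close>.\<close>
  have "\<not> prime (2 * 2 :: nat)" using prime_product[of 2 "2 :: nat"] by auto
  then have "p \<noteq> 4" using p(1) by auto
  then consider "p = 3" | "p = 5" | "6 \<le> p" using p(2) by linarith
  then show ?thesis
  proof cases
    case 1
    \<comment> \<open>\<open>no_divisor_below 2\<close> consists of all positive integers. Odd and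
      even numbers each receive half of \<open>e2\<close>, and the even ones are those with the
      single divisor 2 in the range.\<close>
    obtain e2 where e2: "has_natural_density (no_divisor_below 2) e2"
      using no_divisor_below_density_ex by blast
    from no_divisor_below_Suc_prime[OF two_is_prime_nat this]
    have "has_natural_density (no_divisor_below p) (e2 - e2 / 2)" using 1 by simp
    with e have "e = e2 - e2 / 2" using has_natural_density_unique by blast
    moreover have "(*) 2 ` no_divisor_below 2 \<subseteq> one_divisor_between 1 3"
      by (intro image_subsetI one_divisor_betweenI) (auto simp: no_divisor_below_def)
    from has_natural_density_mono[OF has_natural_density_scale[OF e2] delta1_has_density this]
    have "e2 / 2 \<le> delta1 1 3" by simp
    ultimately show ?thesis using 1 by simp
  next
    case 2
    obtain e3 where e3: "has_natural_density (no_divisor_below 3) e3"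
      using no_divisor_below_density_ex by blast
    \<comment> \<open>A multiple of 4 is already excluded by the divisor 2, so passing from 4 to 5
      removes nothing.\<close>
    have "no_divisor_below 5 = no_divisor_below (Suc 3)"
    proof -
      have "{1<..<5} = {2, 3, 4::nat}" "{1<..<Suc 3} = {2, 3::nat}" by auto
      then show ?thesis
        unfolding no_divisor_below_def by (auto dest: dvd_trans[of 2 4, rotated])
    qed
    moreover have "prime (3::nat)" by simp
    from no_divisor_below_Suc_prime[OF this e3]
    have "has_natural_density (no_divisor_below (Suc 3)) (e3 - e3 / 3)" by simp
    ultimately have e_e3: "e = e3 - e3 / 3"
      using e 2 has_natural_density_unique by metis
    have sub2: "(*) 2 ` no_divisor_below p \<subseteq> one_divisor_between 1 p"
      using 2 by (intro scaled_no_divisor_below_subset) auto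
    \<comment> \<open>The other candidates, 2 and 4, are coprime to every odd \<open>j\<close>, so
      all odd multiples of 3 qualify. Their density is \<open>e3 / 3 = e / 2\<close>, which together
      with the \<open>e / 2\<close> from \<open>sub2\<close> gives exactly \<open>e\<close>.\<close>
    have sub3: "(*) 3 ` no_divisor_below 3 \<subseteq> one_divisor_between 1 p"
    proof
      fix k :: nat assume "k \<in> (*) 3 ` no_divisor_below 3"
      then obtain j where j: "k = 3 * j" "odd j" "j > 0"
        by (auto simp: no_divisor_below_def)
      have "coprime d j" if "d \<in> {1<..<p} - {3}" for d
      proof -
        have "d = 2 \<or> d = 2 * 2" using that 2 by auto
        with j(2) show ?thesis by (auto simp only: coprime_left_2_iff_odd coprime_mult_left_iff)
      qed
      with 2 j(3) show "k \<in> one_divisor_between 1 p"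
        unfolding j(1) by (intro one_divisor_betweenI) auto
    qed
    have "(*) 2 ` no_divisor_below p \<inter> (*) 3 ` no_divisor_below 3 = {}"
    proof -
      have "even k" if "k \<in> (*) 2 ` no_divisor_below p" for k using that by auto
      moreover have "odd k" if "k \<in> (*) 3 ` no_divisor_below 3" for k
        using that by (auto simp: no_divisor_below_def)
      ultimately show ?thesis by blast
    qed
    then have "has_natural_density ((*) 2 ` no_divisor_below p \<union> (*) 3 ` no_divisor_below 3)
        (e / real 2 + e3 / real 3)"
      by (intro has_natural_density_Un has_natural_density_scale e e3) auto
    from has_natural_density_mono[OF this delta1_has_density] sub2 sub3
    have "e / 2 + e3 / 3 \<le> delta1 1 p" by auto
    with e_e3 show ?thesis by simp
  next
    case 3
    let ?A = "\<lambda>q. (*) q ` no_divisor_below p"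
    \<comment> \<open>A member of \<open>?A q\<close> has no divisor in the range other than
      \<open>q\<close>. Hence the smaller of two distinct primes divides every member of its own set
      and none of the other, which makes the sets disjoint.\<close>
    have not_dvd: "\<not> d dvd k" if "k \<in> ?A q" "prime q" "d \<in> {1<..<p}" "d \<noteq> q" for d q k
    proof
      assume "d dvd k"
      with that no_divisor_below_coprime[of _ p d] have "d dvd q"
        by (auto simp: coprime_dvd_mult_left_iff)
      with that show False by (auto simp: prime_nat_iff)
    qed
    have disj: "?A q \<inter> ?A r = {}" if "prime q" "prime r" "q < r" "r < p" for q r
    proof -
      have "\<not> q dvd k" if "k \<in> ?A r" for k
        using that \<open>prime r\<close> \<open>q < r\<close> \<open>r < p\<close> prime_gt_1_nat[OF \<open>prime q\<close>]
        by (intro not_dvd[of k r q]) auto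
      moreover have "q dvd k" if "k \<in> ?A q" for k using that by auto
      ultimately show ?thesis by blast
    qed
    have "?A 2 \<inter> ?A 3 = {}" "?A 2 \<inter> ?A 5 = {}" "?A 3 \<inter> ?A 5 = {}"
      using 3 by (intro disj; simp)+
    then have "?A 2 \<inter> ?A 3 = {}" "(?A 2 \<union> ?A 3) \<inter> ?A 5 = {}"
      by (simp_all only: Int_Un_distrib2 Un_empty)
    then have "has_natural_density (?A 2 \<union> ?A 3 \<union> ?A 5) (e / real 2 + e / real 3 + e / real 5)"
      by (intro has_natural_density_Un has_natural_density_scale e) auto
    moreover have "?A 2 \<union> ?A 3 \<union> ?A 5 \<subseteq> one_divisor_between 1 p"
      using 3 by (intro Un_least scaled_no_divisor_below_subset) auto
    ultimately have "e / 2 + e / 3 + e / 5 \<le> delta1 1 p"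
      using has_natural_density_mono[OF _ delta1_has_density] by fastforce
    \<comment> \<open>The coefficients add up to 31/30, and \<open>e\<close> is nonnegative.\<close>
    with e0 show ?thesis by simp
  qed
qed

text \<open>A multiple of \<open>m\<close> would have two divisors in the enlarged range,
  \<open>m\<close> and a proper divisor \<open>b\<close> of \<open>m\<close>. So \<open>m\<close>
  does not divide \<open>k\<close>, and the count is unchanged.\<close>

lemma one_divisor_between_Suc_composite:
  assumes "\<not> prime m" "1 < m"
  shows "one_divisor_between 1 (Suc m) \<subseteq> one_divisor_between 1 m"
proof
  fix k assume k: "k \<in> one_divisor_between 1 (Suc m)"
  obtain b where b: "b dvd m" "b \<noteq> 1" "b \<noteq> m" using assms by (auto simp: prime_nat_iff)
  moreover have "b \<le> m" "b \<noteq> 0" using b(1) assms(2) by (auto intro: dvd_imp_le intro!: Nat.gr0I)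
  ultimately have b_in: "b \<in> {1<..<m}" by auto
  have "\<not> m dvd k"
  proof
    assume "m dvd k"
    then have "{b, m} \<subseteq> {d \<in> {1<..<Suc m}. d dvd k}"
      using b b_in assms(2) by (auto intro: dvd_trans)
    then have "card {b, m} \<le> card {d \<in> {1<..<Suc m}. d dvd k}" by (intro card_mono) auto
    with k b(3) show False by (simp add: one_divisor_between_def)
  qed
  then have "{d \<in> {1<..<Suc m}. d dvd k} = {d \<in> {1<..<m}. d dvd k}"
    by (auto simp: less_Suc_eq)
  with k show "k \<in> one_divisor_between 1 m" by (simp add: one_divisor_between_def)
qed

text \<open>The first claim splits on whether \<open>p\<close> divides \<open>k\<close>; if it does,
  \<open>p\<close> is the single divisor and the cofactor has none below \<open>p\<close>. The other
  two supply the inclusion and disjointness that turn this set difference and union into a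
  difference and sum of densities.\<close>

lemma one_divisor_between_Suc_prime:
  assumes p: "prime p"
  shows "one_divisor_between 1 (Suc p) \<subseteq>
      (one_divisor_between 1 p - (*) p ` one_divisor_between 1 p) \<union> (*) p ` no_divisor_below p"
    and "(*) p ` one_divisor_between 1 p \<subseteq> one_divisor_between 1 p"
    and "one_divisor_between 1 p \<inter> (*) p ` no_divisor_below p = {}"
proof -
  have p1: "1 < p" using p by (rule prime_gt_1_nat)
  note dvd = dvd_prime_mult_iff_of_less[OF p]
  have eq: "{d \<in> {1<..<p}. d dvd p * j} = {d \<in> {1<..<p}. d dvd j}" for j
    using dvd by blast
  then show "(*) p ` one_divisor_between 1 p \<subseteq> one_divisor_between 1 p"
    using p1 by (auto simp: one_divisor_between_def)
  have "{d \<in> {1<..<p}. d dvd p * j} = {}" if "j \<in> no_divisor_below p" for j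
    unfolding eq using that by (auto simp: no_divisor_below_def)
  then have "p * j \<notin> one_divisor_between 1 p" if "j \<in> no_divisor_below p" for j
    using that unfolding one_divisor_between_def mem_Collect_eq by (metis card.empty zero_neq_one)
  then show "one_divisor_between 1 p \<inter> (*) p ` no_divisor_below p = {}" by blast
  show "one_divisor_between 1 (Suc p) \<subseteq>
      (one_divisor_between 1 p - (*) p ` one_divisor_between 1 p) \<union> (*) p ` no_divisor_below p"
  proof
    fix k assume k: "k \<in> one_divisor_between 1 (Suc p)"
    show "k \<in> (one_divisor_between 1 p - (*) p ` one_divisor_between 1 p) \<union> (*) p ` no_divisor_below p"
    proof (cases "p dvd k")
      case True
      then obtain j where j: "k = p * j" by (elim dvdE)
      have "{d \<in> {1<..<Suc p}. d dvd k} = insert p {d \<in> {1<..<p}. d dvd k}"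
        using True p1 by (auto simp: less_Suc_eq)
      with k have "card {d \<in> {1<..<p}. d dvd k} = 0" by (simp add: one_divisor_between_def)
      with j k eq have "j \<in> no_divisor_below p"
        by (auto simp: one_divisor_between_def no_divisor_below_def)
      with j show ?thesis by auto
    next
      case False
      then have "{d \<in> {1<..<Suc p}. d dvd k} = {d \<in> {1<..<p}. d dvd k}"
        by (auto simp: less_Suc_eq)
      with k False show ?thesis by (auto simp: one_divisor_between_def)
    qed
  qed
qed

lemma delta1_Suc_le:
  assumes "3 \<le> m"
  shows "delta1 1 (Suc m) \<le> delta1 1 m"
proof (cases "prime m")
  case False
  with assms show ?thesis
    by (intro has_natural_density_mono[OF delta1_has_density delta1_has_density]
        one_divisor_between_Suc_composite) auto
next
  case True
  obtain e where e: "has_natural_density (no_divisor_below m) e"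
    using no_divisor_below_density_ex by blast
  let ?O = "one_divisor_between 1 m"
  have m: "0 < m" using assms by simp
  have "(?O - (*) m ` ?O) \<inter> (*) m ` no_divisor_below m = {}"
    using one_divisor_between_Suc_prime(3)[OF True] by blast
  then have "has_natural_density ((?O - (*) m ` ?O) \<union> (*) m ` no_divisor_below m)
      (delta1 1 m - delta1 1 m / real m + e / real m)"
    by (intro has_natural_density_Un has_natural_density_Diff has_natural_density_scale
        delta1_has_density one_divisor_between_Suc_prime True e m)
  from has_natural_density_mono[OF delta1_has_density this one_divisor_between_Suc_prime(1)[OF True]]
  have "delta1 1 (Suc m) \<le> delta1 1 m - delta1 1 m / real m + e / real m" .
  moreover have "e / real m \<le> delta1 1 m / real m"
    using no_divisor_density_le_delta1[OF True assms e] by (rule divide_right_mono) simp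
  ultimately show ?thesis by linarith
qed


section \<open>Unimodality\<close>

text \<open>Otherwise the term just before the least index of \<open>B\<close> would have to be
  strictly smaller, although \<open>f\<close> never increases.\<close>

lemma antimono_on_local_maximum_start:
  assumes f: "antimono_on {a..} f" and B: "local_maximum {a..} f B"
  shows "a \<in> B"
proof (rule ccontr)
  assume "a \<notin> B"
  define i where "i = (LEAST i. i \<in> B)"
  have blk: "B \<noteq> {}" "B \<subseteq> {a..}"
    using B by (auto simp: local_maximum_def maximal_constant_block_def constant_block_def)
  then have i: "i \<in> B" unfolding i_def by (meson LeastI ex_in_conv)
  with blk \<open>a \<notin> B\<close> have "a < i" by (metis atLeast_iff le_neq_implies_less subsetD)
  then obtain j where j: "i = Suc j" "a \<le> j" by (metis less_imp_Suc_add le_add1)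
  have "j \<notin> B" using not_less_Least[of j "\<lambda>i. i \<in> B"] j by (simp add: i_def)
  with j i B have "f j < f i" by (auto simp: local_maximum_def)
  moreover have "f i \<le> f j" using f j by (auto simp: monotone_on_def)
  ultimately show False by simp
qed

text \<open>Both blocks are initial segments of \<open>{a..}\<close> on which \<open>f\<close> has
  the value \<open>f a\<close>. Their union is therefore again a constant block, and maximality
  makes it equal to each of them.\<close>

lemma maximal_constant_blocks_eq:
  assumes B: "maximal_constant_block {a..} f B" and C: "maximal_constant_block {a..} f C"
    and a: "a \<in> B" "a \<in> C"
  shows "B = C"
proof -
  have b: "constant_block {a..} f B" and c: "constant_block {a..} f C"
    using B C by (auto simp: maximal_constant_block_def)
  have init: "j \<in> D" if "constant_block {a..} f D" "a \<in> D" "i \<in> D" "a \<le> j" "j \<le> i" for i j D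
    using that unfolding constant_block_def by (meson atLeastAtMost_iff subsetD)
  have val: "f i = f a" if "i \<in> B \<union> C" for i
    using that a b c unfolding constant_block_def by blast
  have sub: "B \<union> C \<subseteq> {a..}" using b c by (auto simp: constant_block_def)
  have "{i..j} \<subseteq> B \<union> C" if "i \<in> B \<union> C" "j \<in> B \<union> C" for i j
  proof
    fix x assume x: "x \<in> {i..j}"
    have "a \<le> i" using that sub by auto
    with x have "a \<le> x" "x \<le> j" by auto
    with that init[OF b a(1)] init[OF c a(2)] show "x \<in> B \<union> C" by auto
  qed
  moreover have "f i = f j" if "i \<in> B \<union> C" "j \<in> B \<union> C" for i j
    using val[OF that(1)] val[OF that(2)] by simp
  ultimately have "constant_block {a..} f (B \<union> C)"
    using a(1) sub unfolding constant_block_def by (intro conjI ballI) blast+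
  then show ?thesis
    using B C unfolding maximal_constant_block_def by (metis Un_upper1 Un_upper2)
qed

text \<open>Any two local maxima are maximal blocks containing the first index \<open>a\<close>,
  hence coincide.\<close>

lemma antimono_on_imp_unimodal_on:
  assumes "antimono_on {a..} f"
  shows "unimodal_on {a..} f"
  unfolding unimodal_on_def
  using antimono_on_local_maximum_start[OF assms] maximal_constant_blocks_eq
  by (metis local_maximum_def)

theorem theorem1:
  shows "antimono_on {3..} (\<lambda>m. delta1 1 m) \<and> unimodal_on {3..} (\<lambda>m. delta1 1 m)"
proof
  show "antimono_on {3..} (\<lambda>m. delta1 1 m)"
  proof (rule monotone_onI)
    fix m n :: nat assume "m \<in> {3..}" "m \<le> n"
    from this(2) show "delta1 1 n \<le> delta1 1 m"
    proof (induction n rule: dec_induct)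
      case (step n)
      with \<open>m \<in> {3..}\<close> delta1_Suc_le[of n] show ?case by simp
    qed simp
  qed
  then show "unimodal_on {3..} (\<lambda>m. delta1 1 m)" by (rule antimono_on_imp_unimodal_on)
qed

end
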